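(* Let $D_1$ and $D_2$ be two digraphs on $n_1$ and $n_2$ vertices, and $m_1$ and $m_2$ arcs, respectively. Suppose that $D_1$ is $r$-out-regular. Then (1) $$f_{L(D_1\odot D_2)}(\lambda)=(-1)^{n_1}(\lambda-1)^{(r-1)n_1}\,f_{L(D_1)}\bigl(-\lambda^2+\lambda(n_2+r+1)\bigr)\,\bigl[f_{L(D_2)}(\lambda-1)\bigr]^{n_1},$$ (2) $$f_{Q(D_1\odot D_2)}(\lambda)=(\lambda-1)^{(r-1)n_1}\,f_{Q(D_1)}\Bigl(r+(\lambda-1)\bigl(\lambda-r-n_2-\chi_{Q(D_2)}(\lambda-1)\bigr)\Bigr)\,\bigl[f_{Q(D_2)}(\lambda-1)\bigr]^{n_1}.$$ In particular, the $L$-spectrum of $D_1\odot D_2$ is completely determined by the $L$-spectra of $D_1$ and $D_2$, and the $Q$-spectrum of $D_1\odot D_2$ is completely determined by the $Q$-spectra of $D_1$ and $D_2$, and the $Q$-coronal of $D_2$.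
   Context: Digraphs are finite, have at least one vertex, and are simple (no loops, no multiple arcs), but both arcs $uv$ and $vu$ may be present. The adjacency matrix $A(D)=[a_{ij}]$ has $a_{ij}=1$ if $v_iv_j$ is an arc and $0$ otherwise; $D_{\mathrm{out}}(D)$ is the diagonal matrix of out-degrees; $L(D)=D_{\mathrm{out}}(D)-A(D)$ is the Laplacian matrix and $Q(D)=D_{\mathrm{out}}(D)+A(D)$ the signless Laplacian matrix. $D$ is $r$-out-regular if every vertex has out-degree $r$. For an $n\times n$ real matrix $M$, $f_M(\lambda)=\det(\lambda I_n-M)$ and the coronal is $\chi_M(\lambda)=\mathbf 1_n^T(\lambda I_n-M)^{-1}\mathbf 1_n\in\mathbb C(\lambda)$, where $\mathbf 1_n$ is the all-ones column vector. The $L$-spectrum (resp. $Q$-spectrum) of $D$ is the multiset of roots of $f_{L(D)}$ (resp. $f_{Q(D)}$); the $Q$-coronal of $D$ is $\chi_{Q(D)}$. Identities are in $\mathbb C(\lambda)$. "Completely determined by" certain data means that (for $D_1$ ranging over out-regular digraphs) equal data yield equal spectra. The subdivision digraph $\mathcal S(D)$ is obtained from $D$ by replacing each arc $uv$ by a directed path $u\to w\to v$ of length two through a new vertex $w$ (one new vertex per arc). The subdivision-vertex corona $D_1\odot D_2$ is obtained from the disjoint union of $\mathcal S(D_1)$ and $n_1=|V(D_1)|$ copies of $D_2$, one copy $D_2^{(v)}$ for each original vertex $v\in V(D_1)$, by adding, for every $v\in V(D_1)$, both arcs $vw$ and $wv$ for all $w\in V(D_2^{(v)})$. *)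

theory Defs
  imports
    "HOL-Computational_Algebra.Computational_Algebra"
    "HOL-Computational_Algebra.Field_as_Ring"
    "Jordan_Normal_Form.Char_Poly"
    "Jordan_Normal_Form.Gauss_Jordan_Elimination"
    "Graph_Theory.Pair_Digraph"
begin

section \<open>Digraphs\<close>

definition simple_digraph :: "'a pair_pre_digraph \<Rightarrow> bool" where
  "simple_digraph D \<longleftrightarrow> pair_digraph D \<and> pverts D \<noteq> {}"

definition out_regular :: "'a pair_pre_digraph \<Rightarrow> nat \<Rightarrow> bool" where
  "out_regular D r \<longleftrightarrow> (\<forall>v \<in> pverts D. out_degree (with_proj D) v = r)"

text \<open>The new vertex on the arc \<open>(u, v)\<close> is \<open>Inr (u, v)\<close>.\<close>

definition subdivision_digraph :: "'a pair_pre_digraph \<Rightarrow> ('a + 'a \<times> 'a) pair_pre_digraph" where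
  "subdivision_digraph D =
     \<lparr> pverts = Inl ` pverts D \<union> Inr ` parcs D,
       parcs = {(Inl u, Inr (u, v)) | u v. (u, v) \<in> parcs D}
             \<union> {(Inr (u, v), Inl v) | u v. (u, v) \<in> parcs D} \<rparr>"

text \<open>
  \<open>Inl x\<close> is the vertex \<open>x\<close> of the subdivision digraph of \<open>D1\<close>, so an original vertex
  \<open>v\<close> of \<open>D1\<close> appears as \<open>Inl (Inl v)\<close>; \<open>Inr (v, w)\<close> is the vertex \<open>w\<close> in the copy of
  \<open>D2\<close> belonging to \<open>v\<close>.
\<close>

definition subdivision_vertex_corona ::
  "'a pair_pre_digraph \<Rightarrow> 'b pair_pre_digraph \<Rightarrow> (('a + 'a \<times> 'a) + 'a \<times> 'b) pair_pre_digraph"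
  (infixl "\<odot>" 70) where
  "D1 \<odot> D2 =
     \<lparr> pverts = Inl ` pverts (subdivision_digraph D1) \<union> Inr ` (pverts D1 \<times> pverts D2),
       parcs = {(Inl x, Inl y) | x y. (x, y) \<in> parcs (subdivision_digraph D1)}
             \<union> {(Inr (v, x), Inr (v, y)) | v x y. v \<in> pverts D1 \<and> (x, y) \<in> parcs D2}
             \<union> {(Inl (Inl v), Inr (v, w)) | v w. v \<in> pverts D1 \<and> w \<in> pverts D2}
             \<union> {(Inr (v, w), Inl (Inl v)) | v w. v \<in> pverts D1 \<and> w \<in> pverts D2} \<rparr>"

section \<open>Matrices of a digraph\<close>

text \<open>
  The matrices are formed with respect to a listing \<open>vs\<close> of the vertices. They are taken
  over the complex numbers, so that the characteristic polynomials split.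
\<close>

definition vertex_listing :: "'a list \<Rightarrow> 'a pair_pre_digraph \<Rightarrow> bool" where
  "vertex_listing vs D \<longleftrightarrow> distinct vs \<and> set vs = pverts D"

definition adjacency_mat :: "'a pair_pre_digraph \<Rightarrow> 'a list \<Rightarrow> complex mat" where
  "adjacency_mat D vs =
     mat (length vs) (length vs) (\<lambda>(i, j). if (vs ! i, vs ! j) \<in> parcs D then 1 else 0)"

definition out_degree_mat :: "'a pair_pre_digraph \<Rightarrow> 'a list \<Rightarrow> complex mat" where
  "out_degree_mat D vs =
     mat (length vs) (length vs)
       (\<lambda>(i, j). if i = j then of_nat (out_degree (with_proj D) (vs ! i)) else 0)"

definition laplacian_mat :: "'a pair_pre_digraph \<Rightarrow> 'a list \<Rightarrow> complex mat" where
  "laplacian_mat D vs = out_degree_mat D vs - adjacency_mat D vs"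

definition signless_laplacian_mat :: "'a pair_pre_digraph \<Rightarrow> 'a list \<Rightarrow> complex mat" where
  "signless_laplacian_mat D vs = out_degree_mat D vs + adjacency_mat D vs"

definition L_spectrum :: "'a pair_pre_digraph \<Rightarrow> 'a list \<Rightarrow> complex multiset" where
  "L_spectrum D vs = proots (char_poly (laplacian_mat D vs))"

definition Q_spectrum :: "'a pair_pre_digraph \<Rightarrow> 'a list \<Rightarrow> complex multiset" where
  "Q_spectrum D vs = proots (char_poly (signless_laplacian_mat D vs))"

section \<open>Rational functions and coronals\<close>

type_synonym ratfun = "complex poly fract"

definition rat_const :: "complex \<Rightarrow> ratfun" where
  "rat_const c = to_fract [:c:]"

text \<open>The indeterminate of the field of rational functions.\<close>

definition lam :: ratfun where
  "lam = to_fract [:0, 1:]"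

definition poly_at :: "complex poly \<Rightarrow> ratfun \<Rightarrow> ratfun" where
  "poly_at p x = poly (map_poly rat_const p) x"

text \<open>
  Substitution of \<open>x\<close> for the indeterminate in \<open>q\<close>, using the reduced fraction of \<open>q\<close>. It is
  meaningful when the denominator of \<open>q\<close> does not vanish at \<open>x\<close>, in particular for
  every nonconstant \<open>x\<close>.
\<close>

definition ratfun_at :: "ratfun \<Rightarrow> ratfun \<Rightarrow> ratfun" where
  "ratfun_at q x = (case quot_of_fract q of (a, b) \<Rightarrow> poly_at a x / poly_at b x)"

text \<open>\<open>f\<^sub>M(x)\<close>, where \<open>f\<^sub>M\<close> is the characteristic polynomial of \<open>M\<close>.\<close>

definition char_poly_at :: "complex mat \<Rightarrow> ratfun \<Rightarrow> ratfun" where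
  "char_poly_at M x = poly_at (char_poly M) x"

definition coronal :: "complex mat \<Rightarrow> ratfun" where
  "coronal M =
     (let n = dim_row M; ones = vec n (\<lambda>_. 1)
      in ones \<bullet> (the (mat_inverse (lam \<cdot>\<^sub>m 1\<^sub>m n - map_mat rat_const M)) *\<^sub>v ones))"

end

theory Submission
  imports Defs
begin

text \<open>
  Write $s = -1$ for the Laplacian and $s = 1$ for the signless Laplacian, so that both matrices
  are $D_{out} + s A$. Order the vertices of $D_1 \odot D_2$ as the original vertices, then the
  arc vertices, then the copies of $D_2$. With $M_2$ the matrix of $D_2$, the characteristic
  matrix at $t$ has the $3 \times 3$ block form with rows
  $((t - r - n_2) I, -s B, -s I \otimes 1^T)$, $(-s C, (t-1) I, 0)$ and
  $(-s I \otimes 1, 0, I \otimes ((t-1) I - M_2))$,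
  where $B$ and $C$ are the incidence matrices of tails and heads. The ones in $(t-1) I$ come from
  the single arc leaving an arc vertex, and those in $(t-1) I - M_2$ from the extra arc that leads
  back from a copy to its original vertex.

  The lower right part is block diagonal with determinant
  $(t-1)^{r n_1} \det((t-1) I - M_2)^{n_1}$. Its Schur complement only needs two things: $B C$ is
  the adjacency matrix $A_1$ of $D_1$, and $1^T ((t-1) I - M_2)^{-1} 1$ is a scalar $G$. So the
  complement is $(t - r - n_2 - G) I - A_1 / (t-1)$. Because $D_1$ is $r$-out-regular,
  $s A_1$ is the matrix of $D_1$ minus $r I$, and the determinant of the complement is again a
  value of the characteristic polynomial of $D_1$. This is \<open>corona_det\<close>.

  For the signless Laplacian $G$ is by definition the coronal at $\lambda - 1$. For the Laplacian
  the rows of $M_2$ sum to $0$, so $((t-1) I - M_2) 1 = (t-1) 1$ and $G = n_2 / (t-1)$.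

  The identities express the characteristic polynomial of the corona through those of the factors,
  the coronal, and the numbers $n_1$, $n_2$, $r$. A spectrum fixes its monic characteristic
  polynomial; the degree of the latter is the number of vertices, and its second coefficient is
  $- n_1 r$ for $D_1$, since loopfree out-regular digraphs have constant diagonal $r$. Hence the
  spectra of the factors fix $n_1$, $n_2$ and $r$ as well.
\<close>

section \<open>Determinants indexed by a listing\<close>

text \<open>
  Determinants are indexed by objects rather than by positions, so that block decompositions
  become statements about appended lists and sums over blocks become sums over sets of vertices.
\<close>

definition listing_det :: "'a list \<Rightarrow> ('a \<Rightarrow> 'a \<Rightarrow> 'k) \<Rightarrow> 'k :: idom" where
  "listing_det xs f = det (mat (length xs) (length xs) (\<lambda>(i, j). f (xs ! i) (xs ! j)))"

lemma listing_det_cong: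
  assumes "\<And>x y. x \<in> set xs \<Longrightarrow> y \<in> set xs \<Longrightarrow> f x y = g x y"
  shows "listing_det xs f = listing_det xs g"
  unfolding listing_det_def by (intro arg_cong[where f = det] eq_matI) (auto simp: assms)

lemma listing_det_map: "listing_det (map h xs) f = listing_det xs (\<lambda>x y. f (h x) (h y))"
  unfolding listing_det_def by (intro arg_cong[where f = det] eq_matI) auto

lemma listing_det_scale:
  "listing_det xs (\<lambda>x y. c * f x y) = c ^ length xs * listing_det xs f"
proof -
  have "mat (length xs) (length xs) (\<lambda>(i, j). c * f (xs ! i) (xs ! j))
      = c \<cdot>\<^sub>m mat (length xs) (length xs) (\<lambda>(i, j). f (xs ! i) (xs ! j))"
    by (intro eq_matI) auto
  then show ?thesis by (simp add: listing_det_def)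
qed

lemma listing_det_scalar_matrix:
  assumes "distinct xs"
  shows "listing_det xs (\<lambda>x y. if x = y then c else 0) = c ^ length xs"
proof -
  have "mat (length xs) (length xs) (\<lambda>(i, j). if xs ! i = xs ! j then c else 0)
      = c \<cdot>\<^sub>m 1\<^sub>m (length xs)"
    by (intro eq_matI) (use assms in \<open>auto simp: nth_eq_iff_index_eq\<close>)
  then show ?thesis by (simp add: listing_det_def)
qed

text \<open>
  Another listing permutes rows and columns by the same permutation, and the two signs cancel.
\<close>

lemma listing_det_relisting:
  assumes "distinct xs" "distinct ys" "set xs = set ys"
  shows "listing_det xs f = listing_det ys f"
proof -
  define n where "n = length ys"
  have "mset xs = mset ys"
    using assms set_eq_iff_mset_eq_distinct by blast
  then obtain p where p: "p permutes {..<length ys}" "permute_list p ys = xs"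
    by (rule mset_eq_permutation)
  then have p': "p permutes {0..<n}" by (simp add: n_def atLeast0LessThan)
  have len: "length xs = n" using \<open>mset xs = mset ys\<close> n_def by (metis size_mset)
  have nth: "xs ! i = ys ! p i" if "i < n" for i
    using p that by (metis n_def permute_list_nth)
  have lt: "p i < n" if "i < n" for i
    using permutes_in_image[OF p'] that by auto
  let ?A = "mat n n (\<lambda>(i, j). f (ys ! i) (ys ! j))"
  let ?B = "mat n n (\<lambda>(i, j). ?A $$ (p i, j))"
  have xs: "mat n n (\<lambda>(i, j). f (xs ! i) (xs ! j))
      = transpose_mat (mat n n (\<lambda>(i, j). transpose_mat ?B $$ (p i, j)))"
    by (intro eq_matI) (auto simp: nth lt)
  have A: "?A \<in> carrier_mat n n" and B: "transpose_mat ?B \<in> carrier_mat n n" by auto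
  have "listing_det xs f = signof p * det (transpose_mat ?B)"
    unfolding listing_det_def len xs det_permute_rows[OF B p', symmetric]
    by (rule det_transpose) auto
  also have "det (transpose_mat ?B) = det ?B"
    by (rule det_transpose) auto
  also have "det ?B = signof p * det ?A"
    by (rule det_permute_rows[OF A p'])
  finally show ?thesis
    by (simp add: listing_det_def n_def sign_def split: if_splits)
qed

text \<open>
  The Schur complement formula without an inverse: \<open>W\<close> plays the role of $- F_{22}^{-1} F_{21}$,
  and all that is needed of it is that adding the columns of \<open>ys\<close>, weighted by \<open>W\<close>, to those of
  \<open>xs\<close> clears the lower left block.
\<close>

lemma listing_det_append_Schur:
  assumes dist: "distinct ys"
    and cancel: "\<And>x y. x \<in> set xs \<Longrightarrow> y \<in> set ys \<Longrightarrow> f y x + (\<Sum>z\<in>set ys. f y z * W z x) = 0"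
  shows "listing_det (xs @ ys) f
    = listing_det xs (\<lambda>x x'. f x x' + (\<Sum>z\<in>set ys. f x z * W z x')) * listing_det ys f"
proof -
  define n m where "n = length xs" and "m = length ys"
  let ?A = "mat n n (\<lambda>(i, j). f (xs ! i) (xs ! j))"
  let ?B = "mat n m (\<lambda>(i, j). f (xs ! i) (ys ! j))"
  let ?C = "mat m n (\<lambda>(i, j). f (ys ! i) (xs ! j))"
  let ?D = "mat m m (\<lambda>(i, j). f (ys ! i) (ys ! j))"
  let ?W = "mat m n (\<lambda>(i, j). W (ys ! i) (xs ! j))"
  let ?E = "four_block_mat (1\<^sub>m n) (0\<^sub>m n m) ?W (1\<^sub>m m)"
  let ?S = "mat n n (\<lambda>(i, j). f (xs ! i) (xs ! j) + (\<Sum>z\<in>set ys. f (xs ! i) z * W z (xs ! j)))"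
  have sum_ys: "(\<Sum>k = 0..<m. h (ys ! k)) = sum h (set ys)" for h :: "'a \<Rightarrow> 'b"
    by (rule sum.reindex_bij_betw) (use dist in \<open>auto simp: m_def bij_betw_nth atLeast0LessThan\<close>)
  have mult: "four_block_mat ?A ?B ?C ?D * ?E = four_block_mat ?S ?B (0\<^sub>m m n) ?D"
  proof -
    have "?A * 1\<^sub>m n + ?B * ?W = ?S"
      by (intro eq_matI) (auto simp: scalar_prod_def sum_ys[symmetric])
    moreover have "f (ys ! i) (xs ! j) + (\<Sum>k = 0..<m. f (ys ! i) (ys ! k) * W (ys ! k) (xs ! j)) = 0"
      if "i < m" "j < n" for i j
      using cancel[of "xs ! j" "ys ! i"] that
        sum_ys[of "\<lambda>z. f (ys ! i) z * W z (xs ! j)"] by (simp add: n_def m_def)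
    then have "?C * 1\<^sub>m n + ?D * ?W = 0\<^sub>m m n"
      by (intro eq_matI) (auto simp: scalar_prod_def)
    moreover have "?A * 0\<^sub>m n m + ?B * 1\<^sub>m m = ?B" "?C * 0\<^sub>m n m + ?D * 1\<^sub>m m = ?D"
      by auto
    ultimately show ?thesis
      by (subst mult_four_block_mat[of _ n n _ m _ m _ _ n _ m]) auto
  qed
  have "mat (length (xs @ ys)) (length (xs @ ys)) (\<lambda>(i, j). f ((xs @ ys) ! i) ((xs @ ys) ! j))
      = four_block_mat ?A ?B ?C ?D"
    by (intro eq_matI) (auto simp: n_def m_def nth_append)
  then have "listing_det (xs @ ys) f = det (four_block_mat ?A ?B ?C ?D)"
    by (simp add: listing_det_def)
  also have "\<dots> = det (four_block_mat ?A ?B ?C ?D) * det ?E"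
    by (subst det_four_block_mat_upper_right_zero[of _ n _ m]) auto
  also have "\<dots> = det (four_block_mat ?A ?B ?C ?D * ?E)"
    by (rule det_mult[of _ "n + m", symmetric]) auto
  also have "\<dots> = det ?S * det ?D"
    unfolding mult by (rule det_four_block_mat_lower_left_zero) auto
  finally show ?thesis by (simp add: listing_det_def n_def m_def)
qed

corollary listing_det_append_triangular:
  assumes "distinct ys" "\<And>x y. x \<in> set xs \<Longrightarrow> y \<in> set ys \<Longrightarrow> f y x = 0"
  shows "listing_det (xs @ ys) f = listing_det xs f * listing_det ys f"
  using listing_det_append_Schur[of ys xs f "\<lambda>_ _. 0"] assms by simp

text \<open>
  The determinant of $I \otimes h$: splitting off one copy leaves a block triangular matrix.
\<close>

lemma listing_det_copies:
  assumes "distinct vs" "distinct ws"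
  shows "listing_det (List.product vs ws) (\<lambda>(v, x) (v', y). if v = v' then h x y else 0)
    = listing_det ws h ^ length vs"
  using assms(1)
proof (induction vs)
  case Nil
  then show ?case by (simp add: listing_det_def)
next
  case (Cons v vs)
  let ?f = "\<lambda>(v, x) (v', y). if v = v' then h x y else 0"
  have "listing_det (List.product (v # vs) ws) ?f
      = listing_det (map (Pair v) ws) ?f * listing_det (List.product vs ws) ?f"
    unfolding product.simps
    by (rule listing_det_append_triangular) (use Cons.prems assms(2) in \<open>auto simp: distinct_product\<close>)
  with Cons show ?case by (simp add: listing_det_map)
qed

text \<open>
  The second coefficient of a characteristic polynomial is minus the trace. For a constant
  diagonal this follows by induction from the derivative of the characteristic polynomial, which
  is the sum of the characteristic polynomials of the principal submatrices of order \<open>n - 1\<close>: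
  these have the same constant diagonal.
\<close>

lemma char_poly_coeff_constant_diagonal:
  fixes A :: "'k :: {idom, ring_char_0} mat"
  assumes "A \<in> carrier_mat n n" "n > 0" "\<And>i. i < n \<Longrightarrow> A $$ (i, i) = c"
  shows "coeff (char_poly A) (n - 1) = - of_nat n * c"
  using assms
proof (induction n arbitrary: A)
  case 0
  then show ?case by simp
next
  case (Suc n)
  show ?case
  proof (cases "n = 0")
    case True
    then have "char_poly A = [:- c, 1:]"
      using Suc.prems by (simp add: char_poly_defs det_single)
    with True show ?thesis by simp
  next
    case False
    have del: "coeff (char_poly (mat_delete A i i)) (n - 1) = - of_nat n * c" if "i < Suc n" for i
    proof (rule Suc.IH)
      show "mat_delete A i i \<in> carrier_mat n n"
        using Suc.prems(1) mat_delete_carrier[of A "Suc n" "Suc n" i i] by simp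
      show "mat_delete A i i $$ (j, j) = c" if "j < n" for j
        using that Suc.prems \<open>i < Suc n\<close> by (auto simp: mat_delete_def)
    qed (use False in simp)
    have "of_nat n * coeff (char_poly A) n = coeff (pderiv (char_poly A)) (n - 1)"
      using False by (simp add: coeff_pderiv)
    also have "\<dots> = (\<Sum>i<Suc n. coeff (char_poly (mat_delete A i i)) (n - 1))"
      by (simp add: pderiv_char_poly[OF Suc.prems(1)] coeff_sum del: sum.lessThan_Suc)
    also have "\<dots> = (\<Sum>i<Suc n. - of_nat n * c)"
      by (rule sum.cong) (use del in auto)
    also have "\<dots> = of_nat n * (- of_nat (Suc n) * c)"
      by (simp add: algebra_simps)
    finally have "of_nat n * coeff (char_poly A) n = of_nat n * (- of_nat (Suc n) * c)" .
    then show ?thesis using False by (metis diff_Suc_1 mult_cancel_left of_nat_eq_0_iff)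
  qed
qed


section \<open>Substitution into polynomials and rational functions\<close>

lemma rat_const_hom: "comm_ring_hom rat_const"
proof
  show "rat_const 0 = 0" "rat_const 1 = 1"
    by (simp_all add: rat_const_def flip: one_pCons)
  show "rat_const (a + b) = rat_const a + rat_const b"
    "rat_const (a * b) = rat_const a * rat_const b" for a b
    unfolding rat_const_def to_fract_add[symmetric] to_fract_mult[symmetric] by simp_all
qed

lemma poly_at_hom: "comm_ring_hom (\<lambda>p. poly_at p x)"
proof -
  interpret comm_ring_hom rat_const by (rule rat_const_hom)
  interpret mp: map_poly_comm_ring_hom rat_const ..
  show ?thesis by standard (simp_all add: poly_at_def mp.hom_add mp.hom_mult)
qed

lemma poly_at_pCons: "poly_at (pCons c p) x = rat_const c + x * poly_at p x"
proof -
  interpret comm_ring_hom rat_const by (rule rat_const_hom)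
  show ?thesis by (simp add: poly_at_def map_poly_pCons_hom)
qed

text \<open>
  Substituting a polynomial is composition, which makes it easy to see when a substitution is
  injective.
\<close>

lemma poly_at_to_fract: "poly_at p (to_fract q) = to_fract (pcompose p q)"
proof (induction p)
  case 0
  then show ?case by (simp add: poly_at_def)
next
  case (pCons c p)
  then show ?case by (simp add: poly_at_pCons pcompose_pCons rat_const_def)
qed

lemma poly_at_lam: "poly_at p lam = to_fract p"
  by (simp add: lam_def poly_at_to_fract)

lemma poly_at_lam_minus_1_eq_0_iff: "poly_at p (lam - 1) = 0 \<longleftrightarrow> p = 0"
proof -
  have "lam - 1 = to_fract [:-1, 1:]"
    by (simp add: lam_def one_pCons flip: to_fract_1 to_fract_diff)
  then show ?thesis by (simp add: poly_at_to_fract pcompose_eq_0_iff)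
qed

text \<open>
  Substitution of a transcendental element does not depend on the fraction chosen to represent a
  rational function; the injectivity assumption says that \<open>x\<close> is transcendental over the
  constants.
\<close>

lemma ratfun_at_to_fract_divide:
  assumes inj: "\<And>p. poly_at p x = 0 \<longleftrightarrow> p = 0" and "b \<noteq> 0"
  shows "ratfun_at (to_fract a / to_fract b) x = poly_at a x / poly_at b x"
proof -
  interpret comm_ring_hom "\<lambda>p. poly_at p x" by (rule poly_at_hom)
  obtain a' b' where q: "quot_of_fract (to_fract a / to_fract b) = (a', b')" by force
  have "b' \<noteq> 0" using snd_quot_of_fract_nonzero[of "to_fract a / to_fract b"] q by simp
  have "to_fract a / to_fract b = to_fract a' / to_fract b'"
    using Fract_quot_of_fract[of "to_fract a / to_fract b"] q
    by (simp add: Fract_conv_to_fract del: Fract_quot_of_fract)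
  then have "to_fract (a * b') = to_fract (a' * b)"
    using \<open>b \<noteq> 0\<close> \<open>b' \<noteq> 0\<close> by (simp add: field_simps)
  then have "a * b' = a' * b" by (simp only: to_fract_eq_iff)
  then have "poly_at a x * poly_at b' x = poly_at a' x * poly_at b x"
    by (metis hom_mult)
  then show ?thesis
    using \<open>b \<noteq> 0\<close> \<open>b' \<noteq> 0\<close> inj by (simp add: ratfun_at_def q field_simps)
qed

text \<open>
  As a ring homomorphism, substitution carries a linear system over the rational functions,
  together with its solution, to the substituted system. This is how the inverse in the coronal
  is evaluated at $\lambda - 1$.
\<close>

lemma ratfun_at_hom:
  assumes inj: "\<And>p. poly_at p x = 0 \<longleftrightarrow> p = 0"
  shows "comm_ring_hom (\<lambda>q. ratfun_at q x)"
proof -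
  interpret comm_ring_hom "\<lambda>p. poly_at p x" by (rule poly_at_hom)
  note sub = ratfun_at_to_fract_divide[OF inj]
  have frac: "\<exists>a b. q = to_fract a / to_fract b \<and> b \<noteq> 0" for q :: ratfun
    using Fract_quot_of_fract[of q] snd_quot_of_fract_nonzero[of q]
    unfolding Fract_conv_to_fract by metis
  show ?thesis
  proof
    fix p q :: ratfun
    obtain a b c d where p: "p = to_fract a / to_fract b" "b \<noteq> 0"
      and q: "q = to_fract c / to_fract d" "d \<noteq> 0" using frac by metis
    have sum: "p + q = to_fract (a * d + c * b) / to_fract (b * d)"
      using p q by (simp add: field_simps)
    show "ratfun_at (p + q) x = ratfun_at p x + ratfun_at q x"
      unfolding sum unfolding p(1) q(1)
      using p(2) q(2) inj by (simp add: sub hom_distribs add_frac_eq del: to_fract_add to_fract_mult)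
    have prod: "p * q = to_fract (a * c) / to_fract (b * d)"
      using p q by simp
    show "ratfun_at (p * q) x = ratfun_at p x * ratfun_at q x"
      unfolding prod unfolding p(1) q(1)
      using p(2) q(2) inj by (simp add: sub hom_distribs del: to_fract_mult)
  next
    show "ratfun_at 0 x = 0" using sub[of 1 0] by simp
    show "ratfun_at 1 x = 1" using sub[of 1 1] by simp
  qed
qed

lemma char_poly_at_eq_det:
  assumes "M \<in> carrier_mat n n"
  shows "char_poly_at M x = det (x \<cdot>\<^sub>m 1\<^sub>m n - map_mat rat_const M)"
proof -
  interpret comm_ring_hom "\<lambda>p. poly_at p x" by (rule poly_at_hom)
  interpret rc: comm_ring_hom rat_const by (rule rat_const_hom)
  have "map_mat (\<lambda>p. poly_at p x) (char_poly_matrix M) = x \<cdot>\<^sub>m 1\<^sub>m n - map_mat rat_const M"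
    by (intro eq_matI)
      (use assms in \<open>auto simp: char_poly_matrix_def hom_distribs poly_at_pCons\<close>)
  then show ?thesis by (simp add: char_poly_at_def char_poly_def flip: hom_det)
qed

section \<open>Characteristic matrices and coronals of digraphs\<close>

text \<open>
  The entries of $t I - (D_{out} + s A)$: the value $s = -1$ gives the Laplacian and $s = 1$ the
  signless Laplacian, so that both are treated by one computation.
\<close>

definition char_entry :: "'k \<Rightarrow> 'a pair_pre_digraph \<Rightarrow> 'k \<Rightarrow> 'a \<Rightarrow> 'a \<Rightarrow> 'k :: field" where
  "char_entry s D t x y =
     (if x = y then t - of_nat (out_degree (with_proj D) x) else 0)
     - (if (x, y) \<in> parcs D then s else 0)"

lemma char_matrix_laplacian:
  assumes "distinct vs"
  shows "x \<cdot>\<^sub>m 1\<^sub>m (length vs) - map_mat rat_const (laplacian_mat D vs)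
    = mat (length vs) (length vs) (\<lambda>(i, j). char_entry (-1) D x (vs ! i) (vs ! j))"
proof -
  interpret comm_ring_hom rat_const by (rule rat_const_hom)
  show ?thesis
    by (intro eq_matI) (use assms in \<open>auto simp: laplacian_mat_def adjacency_mat_def
      out_degree_mat_def char_entry_def hom_distribs nth_eq_iff_index_eq\<close>)
qed

lemma char_matrix_signless_laplacian:
  assumes "distinct vs"
  shows "x \<cdot>\<^sub>m 1\<^sub>m (length vs) - map_mat rat_const (signless_laplacian_mat D vs)
    = mat (length vs) (length vs) (\<lambda>(i, j). char_entry 1 D x (vs ! i) (vs ! j))"
proof -
  interpret comm_ring_hom rat_const by (rule rat_const_hom)
  show ?thesis
    by (intro eq_matI) (use assms in \<open>auto simp: signless_laplacian_mat_def adjacency_mat_def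
      out_degree_mat_def char_entry_def hom_distribs nth_eq_iff_index_eq\<close>)
qed

lemma laplacian_mat_carrier: "laplacian_mat D vs \<in> carrier_mat (length vs) (length vs)"
  by (rule carrier_matI) (simp_all add: laplacian_mat_def adjacency_mat_def out_degree_mat_def)

lemma signless_laplacian_mat_carrier:
  "signless_laplacian_mat D vs \<in> carrier_mat (length vs) (length vs)"
  by (rule carrier_matI)
    (simp_all add: signless_laplacian_mat_def adjacency_mat_def out_degree_mat_def)

lemma char_poly_at_laplacian:
  "distinct vs \<Longrightarrow> char_poly_at (laplacian_mat D vs) x = listing_det vs (char_entry (-1) D x)"
  by (simp add: char_poly_at_eq_det[OF laplacian_mat_carrier] char_matrix_laplacian listing_det_def)

lemma char_poly_at_signless_laplacian:
  "distinct vs \<Longrightarrow>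
    char_poly_at (signless_laplacian_mat D vs) x = listing_det vs (char_entry 1 D x)"
  by (simp add: char_poly_at_eq_det[OF signless_laplacian_mat_carrier]
      char_matrix_signless_laplacian listing_det_def)

text \<open>
  The coronal only depends on the solution of a linear system with right hand side $1$, not on the
  whole inverse matrix. The inverse exists because the determinant is the characteristic polynomial
  itself, seen as a rational function.
\<close>

lemma coronal_eq_sum_solution:
  assumes M: "M \<in> carrier_mat n n"
  obtains v :: "ratfun vec" where "v \<in> carrier_vec n"
    "(lam \<cdot>\<^sub>m 1\<^sub>m n - map_mat rat_const M) *\<^sub>v v = vec n (\<lambda>_. 1)"
    "coronal M = (\<Sum>i<n. v $ i)"
proof -
  let ?A = "lam \<cdot>\<^sub>m 1\<^sub>m n - map_mat rat_const M"
  let ?ones = "vec n (\<lambda>_. 1) :: ratfun vec"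
  have A: "?A \<in> carrier_mat n n" using M by auto
  have "char_poly M \<noteq> 0" using degree_monic_char_poly[OF M] by auto
  then have "det ?A \<noteq> 0"
    by (simp add: char_poly_at_eq_det[OF M, symmetric] char_poly_at_def poly_at_lam)
  then have "mat_inverse ?A \<noteq> None"
    using mat_inverse(1)[OF A, where b = "()"] det_non_zero_imp_unit[OF A, where b = "()"] by blast
  then obtain B where B: "mat_inverse ?A = Some B" by blast
  note inv = mat_inverse(2)[OF A B]
  show ?thesis
  proof
    show v: "B *\<^sub>v ?ones \<in> carrier_vec n" using inv by auto
    have "?A *\<^sub>v (B *\<^sub>v ?ones) = (?A * B) *\<^sub>v ?ones"
      using inv A by (intro assoc_mult_mat_vec[symmetric]) auto
    then show "?A *\<^sub>v (B *\<^sub>v ?ones) = ?ones" using inv by simp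
    have "coronal M = ?ones \<bullet> (B *\<^sub>v ?ones)"
      using M B by (auto simp: coronal_def Let_def)
    also have "\<dots> = (\<Sum>i<n. (B *\<^sub>v ?ones) $ i)"
      using inv unfolding scalar_prod_def
      by (auto simp: atLeast0LessThan intro!: sum.cong)
    finally show "coronal M = (\<Sum>i<n. (B *\<^sub>v ?ones) $ i)" .
  qed
qed

text \<open>
  The solution of the previous system, moved to $\lambda - 1$ and indexed by vertices. This is the
  form in which the Schur complement uses the coronal.
\<close>

lemma shifted_coronal_eq_sum_solution:
  assumes "vertex_listing vs D"
  obtains g where
    "\<And>x. x \<in> pverts D \<Longrightarrow> (\<Sum>y\<in>pverts D. char_entry 1 D (lam - 1) x y * g y) = 1"
    "(\<Sum>y\<in>pverts D. g y) = ratfun_at (coronal (signless_laplacian_mat D vs)) (lam - 1)"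
proof -
  define n where "n = length vs"
  have dist: "distinct vs" and set: "set vs = pverts D"
    using assms by (auto simp: vertex_listing_def)
  let ?Q = "signless_laplacian_mat D vs"
  let ?shift = "\<lambda>q. ratfun_at q (lam - 1)"
  interpret comm_ring_hom ?shift
    by (rule ratfun_at_hom) (rule poly_at_lam_minus_1_eq_0_iff)
  interpret pa: comm_ring_hom "\<lambda>p. poly_at p (lam - 1)" by (rule poly_at_hom)
  interpret rc: comm_ring_hom rat_const by (rule rat_const_hom)
  have shift_to_fract: "?shift (to_fract p) = poly_at p (lam - 1)" for p
    using ratfun_at_to_fract_divide[OF poly_at_lam_minus_1_eq_0_iff, of 1 p]
    by (simp add: pa.hom_one)
  have shift_lam: "?shift lam = lam - 1"
    using shift_to_fract[of "[:0, 1:]"] unfolding lam_def[symmetric]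
    by (simp add: poly_at_pCons rc.hom_zero rc.hom_one)
  have shift_entry: "?shift (char_entry 1 D lam x y) = char_entry 1 D (lam - 1) x y" for x y
    by (simp add: char_entry_def hom_distribs shift_lam)
  have sum_vs: "(\<Sum>i<n. h (vs ! i)) = sum h (pverts D)" for h :: "'a \<Rightarrow> ratfun"
    by (rule sum.reindex_bij_betw)
      (use dist set in \<open>auto simp: n_def bij_betw_nth\<close>)
  obtain v :: "ratfun vec" where v: "v \<in> carrier_vec n"
    "(lam \<cdot>\<^sub>m 1\<^sub>m n - map_mat rat_const ?Q) *\<^sub>v v = vec n (\<lambda>_. 1)"
    "coronal ?Q = (\<Sum>i<n. v $ i)"
    using coronal_eq_sum_solution[OF signless_laplacian_mat_carrier[of D vs]]
    unfolding n_def by blast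
  \<comment> \<open>The inverse of \<open>(!) vs\<close> turns the coordinates of \<open>v\<close> into a function on vertices.\<close>
  define g where "g y = ?shift (v $ the_inv_into {..<n} ((!) vs) y)" for y
  have g: "g (vs ! i) = ?shift (v $ i)" if "i < n" for i
    using that dist unfolding g_def n_def
    by (subst the_inv_into_f_f) (auto simp: inj_on_nth)
  show ?thesis
  proof
    fix x assume "x \<in> pverts D"
    then obtain i where i: "i < n" "x = vs ! i"
      using set by (metis in_set_conv_nth n_def)
    have "(\<Sum>j<n. char_entry 1 D lam (vs ! i) (vs ! j) * v $ j) = 1"
      using arg_cong[OF v(2), of "\<lambda>w. vec_index w i"] i v(1)
      unfolding char_matrix_signless_laplacian[OF dist, folded n_def]
      by (simp add: scalar_prod_def atLeast0LessThan)
    then have "?shift (\<Sum>j<n. char_entry 1 D lam (vs ! i) (vs ! j) * v $ j) = 1"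
      by simp
    then have "(\<Sum>j<n. char_entry 1 D (lam - 1) x (vs ! j) * g (vs ! j)) = 1"
      by (simp add: hom_distribs shift_entry i g)
    then show "(\<Sum>y\<in>pverts D. char_entry 1 D (lam - 1) x y * g y) = 1"
      using sum_vs[of "\<lambda>y. char_entry 1 D (lam - 1) x y * g y"] by simp
  next
    have "(\<Sum>i<n. g (vs ! i)) = ?shift (coronal ?Q)"
      by (simp add: v(3) hom_distribs g)
    then show "(\<Sum>y\<in>pverts D. g y) = ?shift (coronal ?Q)"
      using sum_vs[of g] by simp
  qed
qed


section \<open>The characteristic matrix of the corona\<close>

lemma out_degree_eq_card_successors: "out_degree (with_proj D) x = card {y. (x, y) \<in> parcs D}"
proof -
  have "out_arcs (with_proj D) x = Pair x ` {y. (x, y) \<in> parcs D}"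
    by (auto simp: out_arcs_def)
  then show ?thesis by (simp add: out_degree_def card_image inj_on_def)
qed

lemma corona_arc_iff:
  "(Inl (Inl u), Inl (Inl v)) \<notin> parcs (D1 \<odot> D2)"
  "(Inl (Inl u), Inl (Inr a)) \<in> parcs (D1 \<odot> D2) \<longleftrightarrow> a \<in> parcs D1 \<and> fst a = u"
  "(Inl (Inr a), Inl (Inl u)) \<in> parcs (D1 \<odot> D2) \<longleftrightarrow> a \<in> parcs D1 \<and> snd a = u"
  "(Inl (Inr a), Inl (Inr b)) \<notin> parcs (D1 \<odot> D2)"
  "(Inl (Inl u), Inr (v, x)) \<in> parcs (D1 \<odot> D2) \<longleftrightarrow> u = v \<and> v \<in> pverts D1 \<and> x \<in> pverts D2"
  "(Inr (v, x), Inl (Inl u)) \<in> parcs (D1 \<odot> D2) \<longleftrightarrow> u = v \<and> v \<in> pverts D1 \<and> x \<in> pverts D2"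
  "(Inl (Inr a), Inr c) \<notin> parcs (D1 \<odot> D2)"
  "(Inr c, Inl (Inr a)) \<notin> parcs (D1 \<odot> D2)"
  "(Inr (v, x), Inr (v', y)) \<in> parcs (D1 \<odot> D2) \<longleftrightarrow> v = v' \<and> v \<in> pverts D1 \<and> (x, y) \<in> parcs D2"
  by (cases a; auto simp: subdivision_vertex_corona_def subdivision_digraph_def)+

lemma pverts_corona:
  "pverts (D1 \<odot> D2) = (Inl \<circ> Inl) ` pverts D1 \<union> (Inl \<circ> Inr) ` parcs D1 \<union> Inr ` (pverts D1 \<times> pverts D2)"
  by (auto simp: subdivision_vertex_corona_def subdivision_digraph_def image_Un image_comp)

context
  fixes D1 :: "'a pair_pre_digraph" and D2 :: "'b pair_pre_digraph"
  assumes D1: "simple_digraph D1" and D2: "simple_digraph D2"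
begin

interpretation D1: pair_digraph D1 using D1 by (simp add: simple_digraph_def)
interpretation D2: pair_digraph D2 using D2 by (simp add: simple_digraph_def)

lemma out_degree_corona_original:
  assumes "v \<in> pverts D1"
  shows "out_degree (with_proj (D1 \<odot> D2)) (Inl (Inl v))
    = out_degree (with_proj D1) v + card (pverts D2)"
proof -
  have "{y. (Inl (Inl v), y) \<in> parcs (D1 \<odot> D2)}
      = (Inl \<circ> Inr \<circ> Pair v) ` {w. (v, w) \<in> parcs D1} \<union> (Inr \<circ> Pair v) ` pverts D2"
  proof (intro equalityI subsetI)
    fix y assume "y \<in> {y. (Inl (Inl v), y) \<in> parcs (D1 \<odot> D2)}"
    then show "y \<in> (Inl \<circ> Inr \<circ> Pair v) ` {w. (v, w) \<in> parcs D1} \<union> (Inr \<circ> Pair v) ` pverts D2"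
      by (cases y rule: sum.exhaust[case_product sum.exhaust])
        (auto simp: corona_arc_iff subdivision_vertex_corona_def subdivision_digraph_def)
  qed (use assms in \<open>auto simp: corona_arc_iff\<close>)
  moreover have fin: "finite {w. (v, w) \<in> parcs D1}"
    by (rule finite_subset[OF _ D1.pair_finite_verts]) (auto dest: D1.in_arcsD2)
  moreover have "card ((Inl \<circ> Inr \<circ> Pair v) ` {w. (v, w) \<in> parcs D1}
        \<union> (Inr \<circ> Pair v) ` pverts D2 :: (('a + 'a \<times> 'a) + 'a \<times> 'b) set)
      = card {w. (v, w) \<in> parcs D1} + card (pverts D2)"
    by (subst card_Un_disjoint)
      (auto simp: fin D2.pair_finite_verts card_image inj_on_def)
  ultimately show ?thesis
    by (simp only: out_degree_eq_card_successors)
qed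

lemma out_degree_corona_arc:
  assumes "a \<in> parcs D1"
  shows "out_degree (with_proj (D1 \<odot> D2)) (Inl (Inr a)) = 1"
proof -
  have "{y. (Inl (Inr a), y) \<in> parcs (D1 \<odot> D2)} = {Inl (Inl (snd a))}"
    using assms by (cases a) (auto simp: subdivision_vertex_corona_def subdivision_digraph_def)
  then show ?thesis by (simp add: out_degree_eq_card_successors)
qed

lemma out_degree_corona_copy:
  assumes "v \<in> pverts D1" "x \<in> pverts D2"
  shows "out_degree (with_proj (D1 \<odot> D2)) (Inr (v, x)) = out_degree (with_proj D2) x + 1"
proof -
  have "{y. (Inr (v, x), y) \<in> parcs (D1 \<odot> D2)}
      = insert (Inl (Inl v)) ((Inr \<circ> Pair v) ` {y. (x, y) \<in> parcs D2})"
    using assms by (auto simp: subdivision_vertex_corona_def subdivision_digraph_def)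
  moreover have "finite {y. (x, y) \<in> parcs D2}"
    by (rule finite_subset[OF _ D2.pair_finite_verts]) (auto dest: D2.in_arcsD2)
  ultimately show ?thesis
    by (simp add: out_degree_eq_card_successors card_insert_if image_iff card_image inj_on_def)
qed

text \<open>
  The blocks of the characteristic matrix of the corona. The arc back to the original vertex raises
  all out-degrees in a copy of \<open>D2\<close> by one, which is why the copy contributes the characteristic
  matrix of \<open>D2\<close> at \<open>t - 1\<close>.
\<close>

lemma char_entry_corona:
  fixes s t :: "'k :: field"
  defines "E \<equiv> char_entry s (D1 \<odot> D2) t"
  shows "u \<in> pverts D1 \<Longrightarrow> E (Inl (Inl u)) (Inl (Inl v))
      = (if u = v then t - of_nat (out_degree (with_proj D1) u) - of_nat (card (pverts D2)) else 0)"
    "a \<in> parcs D1 \<Longrightarrow> E (Inl (Inl u)) (Inl (Inr a)) = - (if fst a = u then s else 0)"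
    "a \<in> parcs D1 \<Longrightarrow> E (Inl (Inr a)) (Inl (Inl u)) = - (if snd a = u then s else 0)"
    "a \<in> parcs D1 \<Longrightarrow> E (Inl (Inr a)) (Inl (Inr b)) = (if a = b then t - 1 else 0)"
    "v \<in> pverts D1 \<Longrightarrow> x \<in> pverts D2 \<Longrightarrow>
      E (Inl (Inl u)) (Inr (v, x)) = - (if v = u then s else 0)"
    "v \<in> pverts D1 \<Longrightarrow> x \<in> pverts D2 \<Longrightarrow>
      E (Inr (v, x)) (Inl (Inl u)) = - (if v = u then s else 0)"
    "E (Inl (Inr a)) (Inr c) = 0"
    "E (Inr c) (Inl (Inr a)) = 0"
    "v \<in> pverts D1 \<Longrightarrow> x \<in> pverts D2 \<Longrightarrow>
      E (Inr (v, x)) (Inr (v', y)) = (if v = v' then char_entry s D2 (t - 1) x y else 0)"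
  unfolding E_def
  by (auto simp: char_entry_def corona_arc_iff out_degree_corona_original out_degree_corona_arc
      out_degree_corona_copy)

text \<open>
  The Schur complement of the original vertices, for both kinds of Laplacian at once; \<open>g\<close> stands for
  $((t-1) I - M_2)^{-1} 1$. The assumption $s^2 = 1$ makes the signs of the two off-diagonal blocks
  cancel in the complement. They reappear when $c I - A_1$ is written as
  $s ((r + s c) I - (r I + s A_1))$, which explains both the factor $s^{n_1}$ and the
  argument at which the characteristic matrix of $D_1$ is taken.
\<close>

lemma corona_det:
  fixes t :: "'k :: field"
  assumes reg: "out_regular D1 r" and s: "s * s = 1" and t: "t \<noteq> 1"
    and vs1: "vertex_listing vs1 D1" and vs2: "vertex_listing vs2 D2"
    and vs: "vertex_listing vs (D1 \<odot> D2)"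
    and g: "\<And>x. x \<in> pverts D2 \<Longrightarrow> (\<Sum>y\<in>pverts D2. char_entry s D2 (t - 1) x y * g y) = 1"
  defines "G \<equiv> \<Sum>y\<in>pverts D2. g y" and "n1 \<equiv> card (pverts D1)" and "n2 \<equiv> card (pverts D2)"
  shows "listing_det vs (char_entry s (D1 \<odot> D2) t)
    = s ^ n1 * (t - 1) powi ((int r - 1) * int n1)
      * listing_det vs1 (char_entry s D1 (of_nat r + s * (t - 1) * (t - of_nat r - of_nat n2 - G)))
      * listing_det vs2 (char_entry s D2 (t - 1)) ^ n1"
proof -
  let ?E = "char_entry s (D1 \<odot> D2) t"
  let ?E1 = "char_entry s D1 (of_nat r + s * (t - 1) * (t - of_nat r - of_nat n2 - G))"
  let ?E2 = "char_entry s D2 (t - 1)"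
  let ?V1 = "pverts D1" and ?V2 = "pverts D2" and ?A = "parcs D1"
  have dist1: "distinct vs1" and set1: "set vs1 = ?V1"
    and dist2: "distinct vs2" and set2: "set vs2 = ?V2"
    and dist: "distinct vs" and set: "set vs = pverts (D1 \<odot> D2)"
    using vs1 vs2 vs by (auto simp: vertex_listing_def)
  have len1: "length vs1 = n1" using distinct_card[OF dist1] by (simp add: set1 n1_def)
  obtain as where as: "set as = ?A" "distinct as"
    using finite_distinct_list[OF D1.pair_finite_arcs] by blast
  have deg: "out_degree (with_proj D1) v = r" if "v \<in> ?V1" for v
    using reg that by (simp add: out_regular_def)
  have len_as: "length as = n1 * r"
  proof -
    have "?A = (SIGMA v:?V1. {w. (v, w) \<in> ?A})" by (auto dest: D1.in_arcsD1)
    then have "card ?A = card (SIGMA v:?V1. {w. (v, w) \<in> ?A})" by simp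
    also have "\<dots> = (\<Sum>v\<in>?V1. card {w. (v, w) \<in> ?A})"
      by (rule card_SigmaI) (auto intro!: D1.pair_finite_verts
          finite_subset[OF _ D1.pair_finite_verts] dest: D1.in_arcsD2)
    also have "\<dots> = n1 * r" using deg by (simp add: out_degree_eq_card_successors n1_def)
    finally show ?thesis using distinct_card[OF as(2)] as(1) by simp
  qed

  define xs :: "(('a + 'a \<times> 'a) + 'a \<times> 'b) list" where "xs = map (\<lambda>v. Inl (Inl v)) vs1"
  define ys1 :: "(('a + 'a \<times> 'a) + 'a \<times> 'b) list" where "ys1 = map (\<lambda>a. Inl (Inr a)) as"
  define ys2 :: "(('a + 'a \<times> 'a) + 'a \<times> 'b) list" where "ys2 = map Inr (List.product vs1 vs2)"
  have dist_ys: "distinct ys1" "distinct ys2" "distinct (ys1 @ ys2)"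
    using dist1 dist2 as by (auto simp: ys1_def ys2_def distinct_map inj_on_def distinct_product)
  have relist: "listing_det vs ?E = listing_det (xs @ ys1 @ ys2) ?E"
  proof (rule listing_det_relisting)
    show "distinct (xs @ ys1 @ ys2)"
      using dist_ys dist1 by (auto simp: xs_def ys1_def ys2_def distinct_map inj_on_def)
    show "set vs = set (xs @ ys1 @ ys2)"
      by (auto simp: set pverts_corona xs_def ys1_def ys2_def set1 set2 as)
  qed (rule dist)

  have sum_ys: "(\<Sum>z\<in>set (ys1 @ ys2). h z)
      = (\<Sum>a\<in>?A. h (Inl (Inr a))) + (\<Sum>v\<in>?V1. \<Sum>x\<in>?V2. h (Inr (v, x)))" for h :: "_ \<Rightarrow> 'k"
  proof -
    have eq: "set (ys1 @ ys2) = (\<lambda>a. Inl (Inr a)) ` ?A \<union> Inr ` (?V1 \<times> ?V2)"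
      by (auto simp: ys1_def ys2_def as set1 set2)
    have "(\<Sum>z\<in>set (ys1 @ ys2). h z) = sum h ((\<lambda>a. Inl (Inr a)) ` ?A) + sum h (Inr ` (?V1 \<times> ?V2))"
      unfolding eq by (rule sum.union_disjoint)
        (auto simp: D1.pair_finite_arcs D1.pair_finite_verts D2.pair_finite_verts)
    also have "sum h ((\<lambda>a. Inl (Inr a)) ` ?A) = (\<Sum>a\<in>?A. h (Inl (Inr a)))"
      by (subst sum.reindex) (auto simp: inj_on_def)
    also have "sum h (Inr ` (?V1 \<times> ?V2)) = (\<Sum>v\<in>?V1. \<Sum>x\<in>?V2. h (Inr (v, x)))"
      by (subst sum.reindex) (auto simp: inj_on_def sum.cartesian_product)
    finally show ?thesis .
  qed

  \<comment> \<open>Minus the inverse of the lower right block times the lower left block: an arc vertex is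
    weighted by \<open>s / (t - 1)\<close> in the column of its head, a copy by \<open>s * g\<close> in the column of its
    original vertex. Rows are arc vertices or copies and columns are original vertices, so
    \<open>projl\<close> and \<open>projr\<close> are only applied to the matching summand.\<close>
  define W :: "(('a + 'a \<times> 'a) + 'a \<times> 'b) \<Rightarrow> (('a + 'a \<times> 'a) + 'a \<times> 'b) \<Rightarrow> 'k" where
    "W z x = (let v = projl (projl x) in
       case z of Inl z' \<Rightarrow> (if snd (projr z') = v then s / (t - 1) else 0)
       | Inr (v', w) \<Rightarrow> (if v' = v then s * g w else 0))" for z x
  have W: "W (Inl (Inr a)) (Inl (Inl v)) = (if snd a = v then s / (t - 1) else 0)"
    "W (Inr (v', w)) (Inl (Inl v)) = (if v' = v then s * g w else 0)" for a v v' w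
    by (simp_all add: W_def)
  note E = char_entry_corona[where s = s and t = t]

  have schur: "listing_det (xs @ ys1 @ ys2) ?E
      = listing_det xs (\<lambda>x x'. ?E x x' + (\<Sum>z\<in>set (ys1 @ ys2). ?E x z * W z x'))
        * listing_det (ys1 @ ys2) ?E"
  proof (rule listing_det_append_Schur[OF dist_ys(3)])
    fix x y assume "x \<in> set xs" "y \<in> set (ys1 @ ys2)"
    then obtain v where v: "v \<in> ?V1" "x = Inl (Inl v)" by (auto simp: xs_def set1)
    consider a where "a \<in> ?A" "y = Inl (Inr a)" | u w where "u \<in> ?V1" "w \<in> ?V2" "y = Inr (u, w)"
      using \<open>y \<in> set (ys1 @ ys2)\<close> by (auto simp: ys1_def ys2_def as set1 set2)
    then show "?E y x + (\<Sum>z\<in>set (ys1 @ ys2). ?E y z * W z x) = 0"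
    proof cases
      case (1 a)
      have "(\<Sum>z\<in>set (ys1 @ ys2). ?E y z * W z x)
          = (\<Sum>b\<in>?A. if a = b then (t - 1) * (if snd a = v then s / (t - 1) else 0) else 0) + 0"
        unfolding sum_ys 1 v using 1 v
        by (intro arg_cong2[where f = "(+)"] sum.cong sum.neutral) (auto simp: E W)
      also have "\<dots> = (if snd a = v then s else 0)"
        using 1 t by (simp add: D1.pair_finite_arcs)
      finally show ?thesis using 1 v by (simp add: E)
    next
      case (2 u w)
      have "(\<Sum>z\<in>set (ys1 @ ys2). ?E y z * W z x)
          = (\<Sum>u'\<in>?V1. \<Sum>w'\<in>?V2. if u' = u then (if u = v then s else 0) * (?E2 w w' * g w') else 0)"
        unfolding sum_ys 2 v using 2 v by (auto simp: E W intro!: sum.cong)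
      also have "\<dots> = (\<Sum>u'\<in>?V1. if u' = u then (if u = v then s else 0) * (\<Sum>w'\<in>?V2. ?E2 w w' * g w') else 0)"
        by (intro sum.cong) (auto simp: sum_distrib_left)
      also have "\<dots> = (if u = v then s else 0)"
        using 2 by (simp add: D1.pair_finite_verts g)
      finally show ?thesis using 2 v by (simp add: E)
    qed
  qed
  have block: "listing_det (ys1 @ ys2) ?E = (t - 1) ^ (n1 * r) * listing_det vs2 ?E2 ^ n1"
  proof -
    have "listing_det (ys1 @ ys2) ?E = listing_det ys1 ?E * listing_det ys2 ?E"
      by (rule listing_det_append_triangular[OF dist_ys(2)])
        (auto simp: ys1_def ys2_def as set1 set2 E)
    also have "listing_det ys1 ?E = listing_det as (\<lambda>a b. if a = b then t - 1 else 0)"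
      unfolding ys1_def listing_det_map by (rule listing_det_cong) (simp add: as E)
    also have "\<dots> = (t - 1) ^ (n1 * r)"
      by (simp add: listing_det_scalar_matrix as len_as)
    also have "listing_det ys2 ?E
        = listing_det (List.product vs1 vs2) (\<lambda>(v, x) (v', y). if v = v' then ?E2 x y else 0)"
      unfolding ys2_def listing_det_map by (rule listing_det_cong) (auto simp: set1 set2 E)
    also have "\<dots> = listing_det vs2 ?E2 ^ n1"
      by (simp add: listing_det_copies dist1 dist2 len1)
    finally show ?thesis .
  qed
  have complement: "listing_det xs (\<lambda>x x'. ?E x x' + (\<Sum>z\<in>set (ys1 @ ys2). ?E x z * W z x'))
      = listing_det vs1 (\<lambda>u v. s / (t - 1) * ?E1 u v)"
    unfolding xs_def listing_det_map
  proof (rule listing_det_cong)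
    fix u v assume "u \<in> set vs1" "v \<in> set vs1"
    then have uv: "u \<in> ?V1" "v \<in> ?V1" by (auto simp: set1)
    have "(\<Sum>a\<in>?A. ?E (Inl (Inl u)) (Inl (Inr a)) * W (Inl (Inr a)) (Inl (Inl v)))
        = (\<Sum>a\<in>?A. if a = (u, v) then - (1 / (t - 1)) else 0)"
      using uv s by (intro sum.cong) (auto simp: E W)
    also have "\<dots> = - (if (u, v) \<in> ?A then 1 / (t - 1) else 0)"
      by (simp add: D1.pair_finite_arcs)
    finally have arcs: "(\<Sum>a\<in>?A. ?E (Inl (Inl u)) (Inl (Inr a)) * W (Inl (Inr a)) (Inl (Inl v)))
      = - (if (u, v) \<in> ?A then 1 / (t - 1) else 0)" .
    have "(\<Sum>v'\<in>?V1. \<Sum>x\<in>?V2. ?E (Inl (Inl u)) (Inr (v', x)) * W (Inr (v', x)) (Inl (Inl v)))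
        = (\<Sum>v'\<in>?V1. if v' = u then (if u = v then - G else 0) else 0)"
      using uv s by (intro sum.cong) (auto simp: E W G_def sum_negf simp flip: mult.assoc)
    also have "\<dots> = (if u = v then - G else 0)"
      using uv by (simp add: D1.pair_finite_verts)
    finally have copies: "(\<Sum>v'\<in>?V1. \<Sum>x\<in>?V2. ?E (Inl (Inl u)) (Inr (v', x)) * W (Inr (v', x)) (Inl (Inl v)))
      = (if u = v then - G else 0)" .
    \<comment> \<open>Out-regularity enters here: the diagonal of \<open>D1\<close> is \<open>r\<close>, so the shift by \<open>of_nat r\<close> in
      the argument of \<open>?E1\<close> removes it.\<close>
    have "s / (t - 1) * ?E1 u v
      = (if u = v then (s * s) * (t - of_nat r - of_nat n2 - G) else 0)
        - (if (u, v) \<in> ?A then (s * s) / (t - 1) else 0)"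
      using t uv by (auto simp: char_entry_def deg field_simps)
    then show "?E (Inl (Inl u)) (Inl (Inl v))
        + (\<Sum>z\<in>set (ys1 @ ys2). ?E (Inl (Inl u)) z * W z (Inl (Inl v)))
      = s / (t - 1) * ?E1 u v"
      unfolding sum_ys arcs copies s using uv by (simp add: E deg n2_def)
  qed
  have power: "(s / (t - 1)) ^ n1 * (t - 1) ^ (n1 * r) = s ^ n1 * (t - 1) powi ((int r - 1) * int n1)"
  proof -
    \<comment> \<open>The exponent is negative when \<open>r = 0\<close>, hence the integer power.\<close>
    have "(int r - 1) * int n1 = int (n1 * r) - int n1" by (simp add: algebra_simps)
    moreover have "(t - 1) powi int (n1 * r) = (t - 1) ^ (n1 * r)" by (rule power_int_of_nat)
    ultimately show ?thesis using t by (simp add: power_int_diff power_divide del: of_nat_mult)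
  qed
  have "listing_det vs ?E = (s / (t - 1)) ^ n1 * (t - 1) ^ (n1 * r)
      * listing_det vs1 ?E1 * listing_det vs2 ?E2 ^ n1"
    unfolding relist schur block complement listing_det_scale len1 by (simp only: mult_ac)
  then show ?thesis unfolding power .
qed

end


section \<open>Characteristic polynomials and spectra of the corona\<close>

lemma lam_neq_1: "lam \<noteq> 1"
  unfolding lam_def to_fract_1[symmetric] to_fract_eq_iff by (simp add: one_pCons)

text \<open>
  The rows of the Laplacian itself sum to zero, because the out-degree counts the arcs subtracted.
\<close>

lemma sum_char_entry_laplacian:
  assumes "simple_digraph D" "x \<in> pverts D"
  shows "(\<Sum>y\<in>pverts D. char_entry (-1) D t x y) = t"
proof -
  interpret pair_digraph D using assms(1) by (simp add: simple_digraph_def)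
  have "{y. (x, y) \<in> parcs D} = {y \<in> pverts D. (x, y) \<in> parcs D}"
    by (auto dest: in_arcsD2)
  then show ?thesis
    using assms(2) pair_finite_verts
    by (simp add: char_entry_def sum_subtractf sum.If_cases out_degree_eq_card_successors Int_def)
qed

text \<open>
  By the row sums, the constant vector $1 / (\lambda - 1)$ solves the system for $D_2$, and the
  coronal of its Laplacian at $\lambda - 1$ is $n_2 / (\lambda - 1)$. The denominator cancels
  against the factor $\lambda - 1$ and leaves a polynomial argument.
\<close>

lemma char_poly_at_laplacian_corona:
  assumes D1: "simple_digraph D1" and D2: "simple_digraph D2" and reg: "out_regular D1 r"
    and vs1: "vertex_listing vs1 D1" and vs2: "vertex_listing vs2 D2"
    and vs: "vertex_listing vs (D1 \<odot> D2)"
  defines "n1 \<equiv> card (pverts D1)" and "n2 \<equiv> card (pverts D2)"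
  shows "char_poly_at (laplacian_mat (D1 \<odot> D2) vs) lam
       = (-1) ^ n1 * (lam - 1) powi ((int r - 1) * int n1)
         * char_poly_at (laplacian_mat D1 vs1) (- (lam ^ 2) + lam * (of_nat n2 + of_nat r + 1))
         * char_poly_at (laplacian_mat D2 vs2) (lam - 1) ^ n1"
proof -
  have lam: "lam - 1 \<noteq> 0" using lam_neq_1 by simp
  have sol: "(\<Sum>y\<in>pverts D2. char_entry (-1) D2 (lam - 1) x y * (1 / (lam - 1))) = 1"
    if "x \<in> pverts D2" for x
    unfolding sum_distrib_right[symmetric] sum_char_entry_laplacian[OF D2 that] using lam by simp
  have arg: "of_nat r + - 1 * (lam - 1) * (lam - of_nat r - of_nat n2 - (\<Sum>y\<in>pverts D2. 1 / (lam - 1)))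
      = - (lam ^ 2) + lam * (of_nat n2 + of_nat r + 1)"
  proof -
    define G where "G = (\<Sum>y\<in>pverts D2. 1 / (lam - 1))"
    have "(lam - 1) * G = of_nat n2"
      using lam by (simp add: n2_def G_def)
    then show ?thesis
      unfolding G_def[symmetric] by (simp add: algebra_simps power2_eq_square)
  qed
  show ?thesis
    using corona_det[OF D1 D2 reg _ lam_neq_1 vs1 vs2 vs sol, folded n1_def n2_def, unfolded arg]
      vs1 vs2 vs
    by (simp add: char_poly_at_laplacian vertex_listing_def)
qed

lemma char_poly_at_signless_laplacian_corona:
  assumes D1: "simple_digraph D1" and D2: "simple_digraph D2" and reg: "out_regular D1 r"
    and vs1: "vertex_listing vs1 D1" and vs2: "vertex_listing vs2 D2"
    and vs: "vertex_listing vs (D1 \<odot> D2)"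
  defines "n1 \<equiv> card (pverts D1)" and "n2 \<equiv> card (pverts D2)"
  shows "char_poly_at (signless_laplacian_mat (D1 \<odot> D2) vs) lam
       = (lam - 1) powi ((int r - 1) * int n1)
         * char_poly_at (signless_laplacian_mat D1 vs1)
             (of_nat r + (lam - 1) *
               (lam - of_nat r - of_nat n2
                 - ratfun_at (coronal (signless_laplacian_mat D2 vs2)) (lam - 1)))
         * char_poly_at (signless_laplacian_mat D2 vs2) (lam - 1) ^ n1"
proof -
  obtain g where g: "\<And>x. x \<in> pverts D2 \<Longrightarrow>
      (\<Sum>y\<in>pverts D2. char_entry 1 D2 (lam - 1) x y * g y) = 1"
    "(\<Sum>y\<in>pverts D2. g y) = ratfun_at (coronal (signless_laplacian_mat D2 vs2)) (lam - 1)"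
    using shifted_coronal_eq_sum_solution[OF vs2] by blast
  show ?thesis
    using corona_det[OF D1 D2 reg _ lam_neq_1 vs1 vs2 vs g(1), folded n1_def n2_def, unfolded g(2)]
      vs1 vs2 vs
    by (simp add: char_poly_at_signless_laplacian vertex_listing_def)
qed

text \<open>
  Complex polynomials split, and characteristic polynomials are monic.
\<close>

lemma char_poly_eq_if_proots_eq:
  fixes M N :: "complex mat"
  assumes "M \<in> carrier_mat m m" "N \<in> carrier_mat n n"
    and "proots (char_poly M) = proots (char_poly N)"
  shows "char_poly M = char_poly N"
  using complex_poly_decompose_multiset[of "char_poly M"]
    complex_poly_decompose_multiset[of "char_poly N"]
    degree_monic_char_poly[OF assms(1)] degree_monic_char_poly[OF assms(2)] assms(3)
  by simp

lemma char_poly_determines_size_and_constant_diagonal: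
  fixes M N :: "'k :: {idom, ring_char_0} mat"
  assumes M: "M \<in> carrier_mat m m" "\<And>i. i < m \<Longrightarrow> M $$ (i, i) = c"
    and N: "N \<in> carrier_mat n n" "\<And>i. i < n \<Longrightarrow> N $$ (i, i) = d"
    and eq: "char_poly M = char_poly N" and pos: "m > 0"
  shows "m = n" "c = d"
proof -
  show "m = n"
    using degree_monic_char_poly[OF M(1)] degree_monic_char_poly[OF N(1)] eq by simp
  then show "c = d"
    using char_poly_coeff_constant_diagonal[OF M(1) _ M(2)]
      char_poly_coeff_constant_diagonal[OF N(1) _ N(2)] eq pos by simp
qed

lemma diagonal_of_out_regular:
  assumes "simple_digraph D" "out_regular D r" "vertex_listing vs D" "i < length vs"
  shows "laplacian_mat D vs $$ (i, i) = of_nat r" "signless_laplacian_mat D vs $$ (i, i) = of_nat r"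
proof -
  interpret pair_digraph D using assms(1) by (simp add: simple_digraph_def)
  have "vs ! i \<in> pverts D" using assms(3,4) by (auto simp: vertex_listing_def)
  then show "laplacian_mat D vs $$ (i, i) = of_nat r"
    "signless_laplacian_mat D vs $$ (i, i) = of_nat r"
    using assms(2,4) no_loops'[of "vs ! i" "vs ! i"]
    by (auto simp: laplacian_mat_def signless_laplacian_mat_def adjacency_mat_def
        out_degree_mat_def out_regular_def)
qed

lemma length_vertex_listing:
  assumes "simple_digraph D" "vertex_listing vs D"
  shows "length vs = card (pverts D)" "length vs > 0"
  using assms distinct_card[of vs] by (auto simp: simple_digraph_def vertex_listing_def)

lemma L_spectrum_eq_iff:
  "L_spectrum D vs = L_spectrum D' vs' \<longleftrightarrow>
    char_poly (laplacian_mat D vs) = char_poly (laplacian_mat D' vs')"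
  unfolding L_spectrum_def
  using char_poly_eq_if_proots_eq[OF laplacian_mat_carrier laplacian_mat_carrier] by metis

lemma Q_spectrum_eq_iff:
  "Q_spectrum D vs = Q_spectrum D' vs' \<longleftrightarrow>
    char_poly (signless_laplacian_mat D vs) = char_poly (signless_laplacian_mat D' vs')"
  unfolding Q_spectrum_def
  using char_poly_eq_if_proots_eq[OF signless_laplacian_mat_carrier signless_laplacian_mat_carrier]
  by metis

lemma card_pverts_eq_degree:
  assumes "simple_digraph D" "vertex_listing vs D"
  shows "card (pverts D) = degree (char_poly (laplacian_mat D vs))"
    "card (pverts D) = degree (char_poly (signless_laplacian_mat D vs))"
  using length_vertex_listing[OF assms] degree_monic_char_poly[OF laplacian_mat_carrier, of D vs]
    degree_monic_char_poly[OF signless_laplacian_mat_carrier, of D vs] by simp_all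

text \<open>
  Equal spectra give equal characteristic polynomials and hence equal orders and out-degrees, so
  that both coronas have literally the same right hand side in the identity above.
\<close>

lemma L_spectrum_corona_determined:
  assumes "simple_digraph D1" "simple_digraph D2" "out_regular D1 r" "vertex_listing vs1 D1"
    "vertex_listing vs2 D2" "vertex_listing vs (D1 \<odot> D2)"
    and "simple_digraph D1'" "simple_digraph D2'" "out_regular D1' r'" "vertex_listing vs1' D1'"
    "vertex_listing vs2' D2'" "vertex_listing vs' (D1' \<odot> D2')"
    and "L_spectrum D1' vs1' = L_spectrum D1 vs1" "L_spectrum D2' vs2' = L_spectrum D2 vs2"
  shows "L_spectrum (D1' \<odot> D2') vs' = L_spectrum (D1 \<odot> D2) vs"
proof -
  note eq = assms(13,14)[unfolded L_spectrum_eq_iff]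
  have "r' = r"
    using char_poly_determines_size_and_constant_diagonal(2)[OF laplacian_mat_carrier
        diagonal_of_out_regular(1)[OF assms(7,9,10)] laplacian_mat_carrier
        diagonal_of_out_regular(1)[OF assms(1,3,4)] eq(1)]
      length_vertex_listing(2)[OF assms(7,10)] by simp
  moreover have "card (pverts D1') = card (pverts D1)" "card (pverts D2') = card (pverts D2)"
    using eq by (simp_all add: card_pverts_eq_degree(1)[OF assms(7,10)]
        card_pverts_eq_degree(1)[OF assms(1,4)] card_pverts_eq_degree(1)[OF assms(8,11)]
        card_pverts_eq_degree(1)[OF assms(2,5)])
  ultimately have "char_poly_at (laplacian_mat (D1' \<odot> D2') vs') lam
      = char_poly_at (laplacian_mat (D1 \<odot> D2) vs) lam"
    unfolding char_poly_at_laplacian_corona[OF assms(1-6)]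
      char_poly_at_laplacian_corona[OF assms(7-12)] by (simp add: char_poly_at_def eq)
  then show ?thesis
    by (simp add: L_spectrum_eq_iff char_poly_at_def poly_at_lam)
qed

lemma Q_spectrum_corona_determined:
  assumes "simple_digraph D1" "simple_digraph D2" "out_regular D1 r" "vertex_listing vs1 D1"
    "vertex_listing vs2 D2" "vertex_listing vs (D1 \<odot> D2)"
    and "simple_digraph D1'" "simple_digraph D2'" "out_regular D1' r'" "vertex_listing vs1' D1'"
    "vertex_listing vs2' D2'" "vertex_listing vs' (D1' \<odot> D2')"
    and "Q_spectrum D1' vs1' = Q_spectrum D1 vs1" "Q_spectrum D2' vs2' = Q_spectrum D2 vs2"
    and coronal: "coronal (signless_laplacian_mat D2' vs2') = coronal (signless_laplacian_mat D2 vs2)"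
  shows "Q_spectrum (D1' \<odot> D2') vs' = Q_spectrum (D1 \<odot> D2) vs"
proof -
  note eq = assms(13,14)[unfolded Q_spectrum_eq_iff]
  have "r' = r"
    using char_poly_determines_size_and_constant_diagonal(2)[OF signless_laplacian_mat_carrier
        diagonal_of_out_regular(2)[OF assms(7,9,10)] signless_laplacian_mat_carrier
        diagonal_of_out_regular(2)[OF assms(1,3,4)] eq(1)]
      length_vertex_listing(2)[OF assms(7,10)] by simp
  moreover have "card (pverts D1') = card (pverts D1)" "card (pverts D2') = card (pverts D2)"
    using eq by (simp_all add: card_pverts_eq_degree(2)[OF assms(7,10)]
        card_pverts_eq_degree(2)[OF assms(1,4)] card_pverts_eq_degree(2)[OF assms(8,11)]
        card_pverts_eq_degree(2)[OF assms(2,5)])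
  ultimately have "char_poly_at (signless_laplacian_mat (D1' \<odot> D2') vs') lam
      = char_poly_at (signless_laplacian_mat (D1 \<odot> D2) vs) lam"
    unfolding char_poly_at_signless_laplacian_corona[OF assms(1-6)]
      char_poly_at_signless_laplacian_corona[OF assms(7-12)]
    by (simp add: char_poly_at_def eq coronal)
  then show ?thesis
    by (simp add: Q_spectrum_eq_iff char_poly_at_def poly_at_lam)
qed

theorem theorem5p3:
  fixes D1 :: "'a pair_pre_digraph" and D2 :: "'b pair_pre_digraph"
    and vs1 :: "'a list" and vs2 :: "'b list" and vs :: "(('a + 'a \<times> 'a) + 'a \<times> 'b) list"
    and n1 n2 r :: nat
  assumes "simple_digraph D1" and "simple_digraph D2"
    and "n1 = card (pverts D1)" and "n2 = card (pverts D2)"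
    and "out_regular D1 r"
    and "vertex_listing vs1 D1" and "vertex_listing vs2 D2" and "vertex_listing vs (D1 \<odot> D2)"
  shows
    "char_poly_at (laplacian_mat (D1 \<odot> D2) vs) lam
       = (-1) ^ n1 * (lam - 1) powi ((int r - 1) * int n1)
         * char_poly_at (laplacian_mat D1 vs1) (- (lam ^ 2) + lam * (of_nat n2 + of_nat r + 1))
         * char_poly_at (laplacian_mat D2 vs2) (lam - 1) ^ n1
     \<and>
     char_poly_at (signless_laplacian_mat (D1 \<odot> D2) vs) lam
       = (lam - 1) powi ((int r - 1) * int n1)
         * char_poly_at (signless_laplacian_mat D1 vs1)
             (of_nat r + (lam - 1) *
               (lam - of_nat r - of_nat n2
                 - ratfun_at (coronal (signless_laplacian_mat D2 vs2)) (lam - 1)))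
         * char_poly_at (signless_laplacian_mat D2 vs2) (lam - 1) ^ n1
     \<and>
     (\<forall>(D1' :: 'c pair_pre_digraph) (D2' :: 'd pair_pre_digraph) r' vs1' vs2' vs'.
        simple_digraph D1' \<and> simple_digraph D2' \<and> out_regular D1' r'
        \<and> vertex_listing vs1' D1' \<and> vertex_listing vs2' D2' \<and> vertex_listing vs' (D1' \<odot> D2')
        \<longrightarrow>
        (L_spectrum D1' vs1' = L_spectrum D1 vs1 \<and> L_spectrum D2' vs2' = L_spectrum D2 vs2
           \<longrightarrow> L_spectrum (D1' \<odot> D2') vs' = L_spectrum (D1 \<odot> D2) vs)
        \<and>
        (Q_spectrum D1' vs1' = Q_spectrum D1 vs1 \<and> Q_spectrum D2' vs2' = Q_spectrum D2 vs2
           \<and> coronal (signless_laplacian_mat D2' vs2') = coronal (signless_laplacian_mat D2 vs2)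
           \<longrightarrow> Q_spectrum (D1' \<odot> D2') vs' = Q_spectrum (D1 \<odot> D2) vs))"
proof (intro conjI allI impI, goal_cases)
  case 1
  show ?case using char_poly_at_laplacian_corona[OF assms(1,2,5-8)] assms(3,4) by simp
next
  case 2
  show ?case using char_poly_at_signless_laplacian_corona[OF assms(1,2,5-8)] assms(3,4) by simp
next
  case (3 D1' D2' r' vs1' vs2' vs')
  then show ?case using L_spectrum_corona_determined[OF assms(1,2,5-8)] by blast
next
  case (4 D1' D2' r' vs1' vs2' vs')
  then show ?case using Q_spectrum_corona_determined[OF assms(1,2,5-8)] by blast
qed

end
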